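(* Let $a>0$, $\lambda>1$, $\epsilon\in(0,1)$, let $$m=2+\left\lfloor\frac{\ln\lambda}{\ln\left(1+\frac{2\epsilon}{d}\right)}\right\rfloor,$$ and consider the geometric grid $$r_i=a\left(\frac1\lambda\right)^{\frac{m-i}{m-1}},\qquad i=1,\dots,m,$$ of $[\frac{a}{\lambda},a]$. Then the following hold. (I) $|\mathbb{P}(r)-\mathbb{P}^*(r)|<\epsilon$ for all $r\in[r_i,r_{i+1}]$ and all $i=1,\dots,m-1$. (II) The equivalent number of grid points of the sample reuse scheme on this grid is $$m_{\mathrm{eq}}(\epsilon)=1+\left(1+\left\lfloor\frac{\ln\lambda}{\ln\left(1+\frac{2\epsilon}{d}\right)}\right\rfloor\right)\left[1-\left(\frac1\lambda\right)^{\frac{d}{1+\left\lfloor\frac{\ln\lambda}{\ln\left(1+\frac{2\epsilon}{d}\right)}\right\rfloor}}\right].$$ (III) The sample reuse factor on this grid satisfies $$\mathcal{F}_{\mathrm{reuse}}>\frac{1}{2\epsilon}\left(1-\frac{1}{1+d\ln\lambda}\right).$$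
   Context: Uncertainty sets and $\mathbb{P}$. The uncertainty lives in $\mathbb{R}^d$, $d\ge1$. The set $\mathcal{B}_1\subset\mathbb{R}^d$ is Lebesgue measurable with $0<\mathrm{vol}(\mathcal{B}_1)<\infty$ and is star-shaped: $cX\in\mathcal{B}_1$ for all $X\in\mathcal{B}_1$ and $c\in[0,1]$. For $r>0$, $\mathcal{B}_r=\{rX : X\in\mathcal{B}_1\}$. A robustness requirement is an arbitrary (measurable) property that each $X\in\mathbb{R}^d$ either satisfies or violates, and $\mathbb{P}(r)=\mathrm{vol}\{X\in\mathcal{B}_r : \text{the requirement is satisfied for }X\}/\mathrm{vol}(\mathcal{B}_r)$, with $\mathrm{vol}$ Lebesgue measure. Interpolation. For a grid $r_1<\cdots<r_m$ and $r\in[r_i,r_{i+1}]$, $\mathbb{P}^*(r)=\frac{(r-r_i)\mathbb{P}(r_{i+1})+(r_{i+1}-r)\mathbb{P}(r_i)}{r_{i+1}-r_i}$. Sample reuse scheme. Fix a sample size $N\ge 1$ and a grid $r_1<\cdots<r_m$. Process the radii in decreasing order $i=m,m-1,\dots,1$. At radius $r_i$, all samples generated previously (for radii $r_k$ with $k>i$) that happen to lie in $\mathcal{B}_{r_i}$ are reused as samples for $r_i$; then as many additional samples, drawn independently (of each other and of the past) and uniformly from $\mathcal{B}_{r_i}$, are generated as needed so that exactly $N$ samples are available for $r_i$. Let $\mathbf{n}_i$ be the (random) number of additional samples generated at radius $r_i$ (so $\mathbf{n}_m=N$), and $\boldsymbol{n}=\sum_{i=1}^m\mathbf{n}_i$.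 The equivalent number of grid points is $m_{\mathrm{eq}}=\mathbb{E}[\boldsymbol{n}]/N$ (written $m_{\mathrm{eq}}(\epsilon)$ when the grid depends on $\epsilon$), and the sample reuse factor is $\mathcal{F}_{\mathrm{reuse}}=\frac{mN}{\mathbb{E}[\boldsymbol{n}]}=\frac{m}{m_{\mathrm{eq}}}$. *)

theory Defs
  imports "HOL-Probability.Probability"
begin

definition scaled_set :: "('a::real_vector) set \<Rightarrow> real \<Rightarrow> 'a set" where
  "scaled_set B r = (\<lambda>X. r *\<^sub>R X) ` B"

definition robust_prob :: "('a::euclidean_space) set \<Rightarrow> ('a \<Rightarrow> bool) \<Rightarrow> real \<Rightarrow> real" where
  "robust_prob B req r =
     measure lebesgue {X \<in> scaled_set B r. req X} / measure lebesgue (scaled_set B r)"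

definition interpolant :: "(real \<Rightarrow> real) \<Rightarrow> (nat \<Rightarrow> real) \<Rightarrow> nat \<Rightarrow> real \<Rightarrow> real" where
  "interpolant f r i x =
     ((x - r i) * f (r (i + 1)) + (r (i + 1) - x) * f (r i)) / (r (i + 1) - r i)"

(* x k j is the value of the j-th fresh sample (counting from 0) drawn at radius r k; only the
   entries with j < additional_samples B r m N x k are actually generated.  The sum counts the
   samples generated at the radii processed before r i that lie in scaled_set B (r i).  For
   star-shaped B and an increasing grid it never exceeds N, because the sets are nested and
   exactly N samples are available at radius r (i + 1); so the subtraction does not truncate. *)
function additional_samples ::
  "('a::real_vector) set \<Rightarrow> (nat \<Rightarrow> real) \<Rightarrow> nat \<Rightarrow> nat \<Rightarrow> (nat \<Rightarrow> nat \<Rightarrow> 'a) \<Rightarrow> nat \<Rightarrow> nat" where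
  "additional_samples B r m N x i =
     N - (\<Sum>k\<in>{i<..m}. card {j. j < additional_samples B r m N x k \<and> x k j \<in> scaled_set B (r i)})"
  by pat_completeness auto
termination
  by (relation "Wellfounded.measure (\<lambda>(B, r, m, N, x, i). m - i)") auto

declare additional_samples.simps [simp del]

definition total_samples ::
  "('a::real_vector) set \<Rightarrow> (nat \<Rightarrow> real) \<Rightarrow> nat \<Rightarrow> nat \<Rightarrow> (nat \<Rightarrow> nat \<Rightarrow> 'a) \<Rightarrow> nat" where
  "total_samples B r m N x = (\<Sum>i=1..m. additional_samples B r m N x i)"

(* The randomness of the sampling scheme: mutually independent draws Y k j, uniform on
   scaled_set B (r k).  At most N fresh draws can be needed at each radius, and the number of
   draws consumed at r k depends only on draws at larger radii. *)
definition uniform_draws ::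
  "'w measure \<Rightarrow> ('a::euclidean_space) set \<Rightarrow> (nat \<Rightarrow> real) \<Rightarrow> nat \<Rightarrow> nat
     \<Rightarrow> (nat \<Rightarrow> nat \<Rightarrow> 'w \<Rightarrow> 'a) \<Rightarrow> bool" where
  "uniform_draws M B r m N Y \<longleftrightarrow>
     prob_space.indep_vars M (\<lambda>_. lebesgue) (\<lambda>(k, j). Y k j) ({1..m} \<times> {..<N}) \<and>
     (\<forall>k\<in>{1..m}. \<forall>j<N. distr M lebesgue (Y k j) = uniform_measure lebesgue (scaled_set B (r k)))"

definition expected_total ::
  "'w measure \<Rightarrow> ('a::real_vector) set \<Rightarrow> (nat \<Rightarrow> real) \<Rightarrow> nat \<Rightarrow> nat
     \<Rightarrow> (nat \<Rightarrow> nat \<Rightarrow> 'w \<Rightarrow> 'a) \<Rightarrow> real" where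
  "expected_total M B r m N Y =
     (\<integral>\<omega>. real (total_samples B r m N (\<lambda>k j. Y k j \<omega>)) \<partial>M)"

definition equiv_grid_points ::
  "'w measure \<Rightarrow> ('a::real_vector) set \<Rightarrow> (nat \<Rightarrow> real) \<Rightarrow> nat \<Rightarrow> nat
     \<Rightarrow> (nat \<Rightarrow> nat \<Rightarrow> 'w \<Rightarrow> 'a) \<Rightarrow> real" where
  "equiv_grid_points M B r m N Y = expected_total M B r m N Y / real N"

definition reuse_factor ::
  "'w measure \<Rightarrow> ('a::real_vector) set \<Rightarrow> (nat \<Rightarrow> real) \<Rightarrow> nat \<Rightarrow> nat
     \<Rightarrow> (nat \<Rightarrow> nat \<Rightarrow> 'w \<Rightarrow> 'a) \<Rightarrow> real" where
  "reuse_factor M B r m N Y = real m * real N / expected_total M B r m N Y"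

end

theory Submission imports Defs begin

text \<open>
  Between nested dilates \<open>s \<le> t\<close> the success probability changes by at most the relative volume
  difference \<open>1 - (s/t)^d\<close>, so by Bernoulli's inequality linear interpolation on \<open>[u, v]\<close> errs by at
  most \<open>d (v - u) / (2 u)\<close>, and the grid ratio is below \<open>1 + 2 \<epsilon> / d\<close>.
  For the sample count, a fresh draw at \<open>r k\<close> lands in the \<open>i\<close>-th set with probability \<open>v i / v k\<close>
  (\<open>v\<close> the volume), which turns the scheme into the linear recursion
  \<open>(\<Sum>k\<ge>i. E k / v k) = N / v i\<close> for the expected numbers \<open>E k\<close> of fresh draws.
  The bound on the reuse factor then follows from \<open>1 - exp (-y) \<le> y\<close> and \<open>ln (1 + x) \<le> x\<close>.
\<close>

subsection \<open>Dilates of star-shaped sets\<close>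

lemma measure_scaled_set:
  fixes B :: "('a::euclidean_space) set"
  shows "measure lebesgue (scaled_set B r) = \<bar>r\<bar> ^ DIM('a) * measure lebesgue B"
  using measure_lebesgue_affine[of r 0 B] by (simp add: scaled_set_def)

lemma emeasure_scaled_set:
  fixes B :: "('a::euclidean_space) set"
  shows "emeasure lebesgue (scaled_set B r) = ennreal (\<bar>r\<bar> ^ DIM('a)) * emeasure lebesgue B"
  using emeasure_lebesgue_affine[of r 0 B] by (simp add: scaled_set_def ennreal_power)

text \<open>For \<open>r \<noteq> 0\<close> the dilate is the preimage of \<open>B\<close> under
  scaling by \<open>1 / r\<close>. This breaks down at \<open>r = 0\<close>, where the dilate lies
  in the null set \<open>{0}\<close>.\<close>

lemma sets_lebesgue_scaled_set:
  fixes B :: "('a::euclidean_space) set"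
  assumes "B \<in> sets lebesgue"
  shows "scaled_set B r \<in> sets lebesgue"
proof (cases "r = 0")
  case True
  then have "scaled_set B r \<subseteq> {0}" by (auto simp: scaled_set_def)
  then have "negligible (scaled_set B r)" using negligible_subset negligible_sing by blast
  then show ?thesis by (rule negligible_imp_sets)
next
  case False
  then have "scaled_set B r = (*\<^sub>R) (1 / r) -` B \<inter> space lebesgue"
    by (force simp: scaled_set_def image_iff)
  then show ?thesis
    using measurable_sets[OF lebesgue_measurable_scaling assms] by metis
qed

lemma lmeasurable_scaled_set:
  fixes B :: "('a::euclidean_space) set"
  assumes "B \<in> lmeasurable"
  shows "scaled_set B r \<in> lmeasurable"
  using assms by (auto simp: fmeasurable_def sets_lebesgue_scaled_set emeasure_scaled_set ennreal_mult_less_top)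

text \<open>This is the one place where star-shapedness enters: the later arguments use only that
  the dilates are nested.\<close>

lemma scaled_set_mono:
  assumes star: "\<And>X c. X \<in> B \<Longrightarrow> 0 \<le> c \<Longrightarrow> c \<le> 1 \<Longrightarrow> c *\<^sub>R X \<in> B"
    and "0 \<le> s" "s \<le> t" "0 < t"
  shows "scaled_set B s \<subseteq> scaled_set B t"
proof
  fix Z assume "Z \<in> scaled_set B s"
  then obtain X where X: "X \<in> B" "Z = s *\<^sub>R X" by (auto simp: scaled_set_def)
  then have "Z = t *\<^sub>R ((s / t) *\<^sub>R X)" using assms by simp
  moreover have "(s / t) *\<^sub>R X \<in> B" using star[of X "s / t"] X assms by simp
  ultimately show "Z \<in> scaled_set B t" unfolding scaled_set_def by (rule image_eqI)
qed

subsection \<open>Interpolation error\<close>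

text \<open>Let \<open>q\<close> be the ratio of the two volumes and \<open>p\<close> the success
  probability at \<open>s\<close>. Going from \<open>s\<close> to \<open>t\<close>, the satisfying
  volume grows by at least 0 and at most the volume of the shell, so the probability at
  \<open>t\<close> lies in \<open>[p q, p q + 1 - q]\<close>. This interval has length
  \<open>1 - q\<close> and also contains \<open>p = p q + p (1 - q)\<close>.\<close>

lemma robust_prob_diff_le:
  fixes B :: "('a::euclidean_space) set"
  assumes B: "B \<in> lmeasurable" "0 < measure lebesgue B"
    and star: "\<And>X c. X \<in> B \<Longrightarrow> 0 \<le> c \<Longrightarrow> c \<le> 1 \<Longrightarrow> c *\<^sub>R X \<in> B"
    and req: "{X. req X} \<in> sets lebesgue"
    and st: "0 < s" "s \<le> t"
  shows "\<bar>robust_prob B req t - robust_prob B req s\<bar> \<le> 1 - (s / t) ^ DIM('a)"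
proof -
  let ?\<mu> = "measure lebesgue" and ?S = "scaled_set B s" and ?T = "scaled_set B t"
  define Vs where "Vs = ?\<mu> (?S \<inter> {X. req X})"
  define Vt where "Vt = ?\<mu> (?T \<inter> {X. req X})"
  define q where "q = (s / t) ^ DIM('a)"
  have sub: "?S \<subseteq> ?T" using scaled_set_mono[OF star] st by auto
  have fm: "?S \<in> lmeasurable" "?T \<in> lmeasurable" using lmeasurable_scaled_set B by auto
  have fmr: "?S \<inter> {X. req X} \<in> lmeasurable" "?T \<inter> {X. req X} \<in> lmeasurable"
    using fm req by (auto intro: fmeasurable_Int_fmeasurable)
  have pos: "0 < ?\<mu> ?S" "0 < ?\<mu> ?T" using B st by (auto simp: measure_scaled_set)
  have ratio: "?\<mu> ?S = q * ?\<mu> ?T"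
    using st B by (simp add: measure_scaled_set q_def power_divide)
  have q: "0 < q" "q \<le> 1" using st by (auto simp: q_def power_le_one)
  have "Vs \<le> Vt" unfolding Vs_def Vt_def
    using sub fmr by (intro measure_mono_fmeasurable) auto
  have "Vs \<le> ?\<mu> ?S" unfolding Vs_def
    using fmr fm by (intro measure_mono_fmeasurable) auto
  \<comment> \<open>Worst case: the requirement holds on the whole shell
    \<open>?T - ?S\<close>.\<close>
  have "Vt \<le> ?\<mu> (?S \<inter> {X. req X} \<union> (?T - ?S))" unfolding Vt_def
    using fm fmr by (intro measure_mono_fmeasurable) auto
  also have "\<dots> \<le> Vs + ?\<mu> (?T - ?S)" unfolding Vs_def
    using fm fmr by (intro measure_Un_le) auto
  also have "?\<mu> (?T - ?S) = ?\<mu> ?T - ?\<mu> ?S"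
    using fm sub by (simp add: measurable_measure_Diff fmeasurableD)
  finally have upper: "Vt \<le> Vs + ?\<mu> ?T - ?\<mu> ?S" by simp
  define p where "p = Vs / ?\<mu> ?S"
  have Vs: "Vs = p * (q * ?\<mu> ?T)" using pos ratio q by (simp add: p_def)
  have p: "0 \<le> p" "p \<le> 1" using \<open>Vs \<le> ?\<mu> ?S\<close> pos by (auto simp: p_def Vs_def)
  have "Vt \<le> (p * q + 1 - q) * ?\<mu> ?T" "p * q * ?\<mu> ?T \<le> Vt"
    using upper \<open>Vs \<le> Vt\<close> Vs ratio by (auto simp: algebra_simps)
  then have *: "Vt / ?\<mu> ?T \<le> p * q + 1 - q" "p * q \<le> Vt / ?\<mu> ?T"
    using pos by (auto simp: pos_divide_le_eq pos_le_divide_eq)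
  have "p * (1 - q) \<ge> 0" "p * (1 - q) \<le> 1 - q"
    using p q mult_left_le_one_le[of "1 - q" p] by auto
  then have "\<bar>Vt / ?\<mu> ?T - p\<bar> \<le> 1 - q" using * by (auto simp: algebra_simps abs_le_iff)
  moreover have "robust_prob B req t = Vt / ?\<mu> ?T" "robust_prob B req s = p"
    by (auto simp: robust_prob_def Vt_def Vs_def p_def Int_def)
  ultimately show ?thesis by (simp add: q_def)
qed

text \<open>Bernoulli's inequality for the base \<open>s / t = 1 + (- (t - s) / t)\<close>.\<close>

lemma one_minus_ratio_power_le:
  fixes s t :: real
  assumes "0 < s" "s \<le> t"
  shows "1 - (s / t) ^ n \<le> real n * (t - s) / t"
proof -
  have "-1 \<le> - (t - s) / t" using assms by (simp add: field_simps)
  from Bernoulli_inequality[OF this, of n] show ?thesis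
    using assms by (simp add: field_simps)
qed

text \<open>The error is the convex combination of \<open>f x - f v\<close> and
  \<open>f x - f u\<close> with weights \<open>(x - u) / h\<close> and \<open>(v - x) / h\<close>.
  Each difference is small when its weight is large, so the product \<open>(x - u) (v - x)\<close>
  governs the error.\<close>

lemma interpolation_error_less:
  fixes f :: "real \<Rightarrow> real"
  assumes f: "\<And>s t. 0 < s \<Longrightarrow> s \<le> t \<Longrightarrow> \<bar>f t - f s\<bar> \<le> 1 - (s / t) ^ n"
    and u: "0 < r i" "r i < r (i + 1)" "real n * (r (i + 1) - r i) < 2 * eps * r i"
    and x: "x \<in> {r i..r (i + 1)}"
  shows "\<bar>f x - interpolant f r i x\<bar> < eps"
proof -
  define u v h where "u = r i" and "v = r (i + 1)" and "h = v - u"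
  have uv: "0 < u" "u < v" "u \<le> x" "x \<le> v" "0 < x" "0 < h" and small: "real n * h < 2 * eps * u"
    using u x by (auto simp: u_def v_def h_def)
  have b1: "\<bar>f v - f x\<bar> \<le> real n * (v - x) / u"
  proof -
    have "\<bar>f v - f x\<bar> \<le> real n * (v - x) / v"
      using f[of x v] one_minus_ratio_power_le[of x v n] uv by linarith
    \<comment> \<open>Both increments are bounded over the common denominator \<open>u\<close>, the
      smallest radius, so that they can be combined.\<close>
    also have "\<dots> \<le> real n * (v - x) / u" using uv by (intro divide_left_mono) auto
    finally show ?thesis .
  qed
  have b2: "\<bar>f x - f u\<bar> \<le> real n * (x - u) / u"
  proof -
    have "\<bar>f x - f u\<bar> \<le> real n * (x - u) / x"
      using f[of u x] one_minus_ratio_power_le[of u x n] uv by linarith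
    also have "\<dots> \<le> real n * (x - u) / u" using uv by (intro divide_left_mono) auto
    finally show ?thesis .
  qed
  have "(f x - interpolant f r i x) * h = (x - u) * (f x - f v) + (v - x) * (f x - f u)"
    using uv by (simp add: interpolant_def u_def v_def h_def field_simps)
  then have "\<bar>f x - interpolant f r i x\<bar> * h = \<bar>(x - u) * (f x - f v) + (v - x) * (f x - f u)\<bar>"
    using uv by (metis abs_mult abs_of_pos)
  also have "\<dots> \<le> (x - u) * \<bar>f v - f x\<bar> + (v - x) * \<bar>f x - f u\<bar>"
    using uv abs_triangle_ineq[of "(x - u) * (f x - f v)" "(v - x) * (f x - f u)"]
    by (simp add: abs_mult abs_minus_commute)
  also have "\<dots> \<le> (x - u) * (real n * (v - x) / u) + (v - x) * (real n * (x - u) / u)"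
    using b1 b2 uv by (intro add_mono mult_left_mono) auto
  also have "\<dots> = real n / (2 * u) * (4 * ((x - u) * (v - x)))" using uv by (simp add: divide_simps)
  also have "\<dots> \<le> real n / (2 * u) * h\<^sup>2"
  proof (rule mult_left_mono)
    \<comment> \<open>AM-GM for two numbers with sum \<open>h\<close>; it yields the factor 1/2 that
      permits \<open>2 * eps\<close> in the step condition.\<close>
    have "h\<^sup>2 - 4 * ((x - u) * (v - x)) = ((x - u) - (v - x))\<^sup>2"
      by (simp add: h_def power2_eq_square algebra_simps)
    then show "4 * ((x - u) * (v - x)) \<le> h\<^sup>2" by (smt (verit) zero_le_power2)
  qed (use uv in simp)
  also have "\<dots> = (real n * h / (2 * u)) * h" by (simp add: power2_eq_square)
  also have "\<dots> < eps * h"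
    using small uv by (intro mult_strict_right_mono) (auto simp: field_simps)
  finally show ?thesis using uv by simp
qed

subsection \<open>The sample reuse scheme\<close>

text \<open>Downward induction from \<open>m\<close>: at radius \<open>r (n + 1)\<close> reused and
  fresh samples together number exactly \<open>N\<close>, and by nestedness everything reusable at
  \<open>r n\<close> is among them. Hence the natural-number subtraction in the recursion never
  truncates.\<close>

lemma reused_samples_le:
  assumes mono: "\<And>i j. 1 \<le> i \<Longrightarrow> i \<le> j \<Longrightarrow> j \<le> m \<Longrightarrow> scaled_set B (r i) \<subseteq> scaled_set B (r j)"
    and i: "1 \<le> i" "i \<le> m"
  shows "(\<Sum>k\<in>{i<..m}. card {j. j < additional_samples B r m N x k \<and> x k j \<in> scaled_set B (r i)}) \<le> N"
  using i(2)
proof (induction rule: inc_induct)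
  case base
  show ?case by simp
next
  case (step n)
  let ?A = "additional_samples B r m N x"
  let ?C = "\<lambda>k i. card {j. j < ?A k \<and> x k j \<in> scaled_set B (r i)}"
  have "{n<..m} = insert (Suc n) {Suc n<..m}" using step by auto
  then have "(\<Sum>k\<in>{n<..m}. ?C k n) = ?C (Suc n) n + (\<Sum>k\<in>{Suc n<..m}. ?C k n)" by simp
  also have "?C (Suc n) n \<le> card {..<?A (Suc n)}" by (intro card_mono) auto
  also have "card {..<?A (Suc n)} = N - (\<Sum>k\<in>{Suc n<..m}. ?C k (Suc n))"
    by (simp add: additional_samples.simps[of B r m N x "Suc n"])
  also have "(\<Sum>k\<in>{Suc n<..m}. ?C k n) \<le> (\<Sum>k\<in>{Suc n<..m}. ?C k (Suc n))"
    using mono[of n "Suc n"] i step by (intro sum_mono card_mono) auto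
  finally show ?case using step.IH by simp
qed

lemma additional_samples_le: "additional_samples B r m N x i \<le> N"
  by (subst additional_samples.simps) simp

text \<open>As an identity of reals the recursion is linear, so expectations can be taken term by
  term.\<close>

lemma real_additional_samples:
  assumes "\<And>i j. 1 \<le> i \<Longrightarrow> i \<le> j \<Longrightarrow> j \<le> m \<Longrightarrow> scaled_set B (r i) \<subseteq> scaled_set B (r j)"
    and "1 \<le> i" "i \<le> m"
  shows "real (additional_samples B r m N x i) = real N -
    (\<Sum>k\<in>{i<..m}. real (card {j. j < additional_samples B r m N x k \<and> x k j \<in> scaled_set B (r i)}))"
proof -
  have "(\<Sum>k\<in>{i<..m}. card {j. j < additional_samples B r m N x k \<and> x k j \<in> scaled_set B (r i)}) \<le> N"
    using assms by (rule reused_samples_le)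
  then show ?thesis
    by (simp add: additional_samples.simps[of B r m N x i])
qed

text \<open>This expresses that the scheme looks only at the past. Draws with
  \<open>j \<ge> N\<close> are never inspected because no radius consumes more than
  \<open>N\<close>. The independence argument uses it to restrict the draws to a finite block of
  indices.\<close>

lemma additional_samples_cong:
  assumes "\<And>k j. i < k \<Longrightarrow> k \<le> m \<Longrightarrow> j < N \<Longrightarrow> x k j = y k j"
  shows "additional_samples B r m N x i = additional_samples B r m N y i"
  using assms
proof (induction "m - i" arbitrary: i rule: less_induct)
  case less
  have "{j. j < additional_samples B r m N x k \<and> x k j \<in> scaled_set B (r i)} =
        {j. j < additional_samples B r m N y k \<and> y k j \<in> scaled_set B (r i)}" if "k \<in> {i<..m}" for k
  proof -
    have "additional_samples B r m N x k = additional_samples B r m N y k"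
      using that less.prems by (intro less.hyps) auto
    then show ?thesis
      using that less.prems additional_samples_le[of B r m N y k] by (auto dest: order_less_le_trans)
  qed
  then have "(\<Sum>k\<in>{i<..m}. card {j. j < additional_samples B r m N x k \<and> x k j \<in> scaled_set B (r i)}) =
        (\<Sum>k\<in>{i<..m}. card {j. j < additional_samples B r m N y k \<and> y k j \<in> scaled_set B (r i)})"
    by (intro sum.cong refl arg_cong[where f = card])
  then show ?case
    by (simp add: additional_samples.simps[of B r m N _ i])
qed

text \<open>A count with a random bound becomes a sum over a fixed range, on which measurability and
  expectation act termwise.\<close>

lemma card_less_conj_eq_sum:
  fixes a N :: nat
  assumes "a \<le> N"
  shows "card {j. j < a \<and> P j} = (\<Sum>j<N. if j < a \<and> P j then 1 else 0)"
proof -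
  have "{j. j < a \<and> P j} = {j \<in> {..<N}. j < a \<and> P j}" using assms by auto
  then show ?thesis by (simp add: sum.If_cases Int_def)
qed

text \<open>Only the draws at indices above \<open>i\<close> are assumed measurable, so the lemma
  serves both for the draws on the probability space and for the coordinates of a product over later
  indices only.\<close>

lemma measurable_additional_samples:
  fixes B :: "('a::euclidean_space) set"
  assumes B: "B \<in> sets lebesgue"
    and X: "\<And>k j. i < k \<Longrightarrow> k \<le> m \<Longrightarrow> j < N \<Longrightarrow> X k j \<in> M \<rightarrow>\<^sub>M lebesgue"
  shows "(\<lambda>\<omega>. additional_samples B r m N (\<lambda>k j. X k j \<omega>) i) \<in> M \<rightarrow>\<^sub>M count_space UNIV"
  using X
proof (induction "m - i" arbitrary: i rule: less_induct)
  case less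
  note [measurable] = sets_lebesgue_scaled_set[OF B, of "r i"]
  have "(\<lambda>\<omega>. \<Sum>j<N. if j < additional_samples B r m N (\<lambda>k j. X k j \<omega>) k
            \<and> X k j \<omega> \<in> scaled_set B (r i) then 1 else (0::nat)) \<in> M \<rightarrow>\<^sub>M count_space UNIV"
    if k: "k \<in> {i<..m}" for k
  proof -
    have [measurable]: "(\<lambda>\<omega>. additional_samples B r m N (\<lambda>k j. X k j \<omega>) k) \<in> M \<rightarrow>\<^sub>M count_space UNIV"
      using k less.prems by (intro less.hyps) auto
    have [measurable]: "X k j \<in> M \<rightarrow>\<^sub>M lebesgue" if "j < N" for j
      using k less.prems that by auto
    show ?thesis by measurable
  qed
  then have "(\<lambda>\<omega>. \<Sum>k\<in>{i<..m}. \<Sum>j<N. if j < additional_samples B r m N (\<lambda>k j. X k j \<omega>) k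
            \<and> X k j \<omega> \<in> scaled_set B (r i) then 1 else (0::nat)) \<in> M \<rightarrow>\<^sub>M count_space UNIV"
    by (rule measurable_sum_nat)
  from measurable_compose[OF this measurable_count_space, of "\<lambda>s. N - s"] show ?case
    by (subst additional_samples.simps, subst card_less_conj_eq_sum[OF additional_samples_le])
qed

text \<open>The number of draws consumed at radius \<open>r k\<close> is determined by the draws at larger radii, hence
  independent of each draw at \<open>r k\<close> itself; this gives a Wald-type identity.\<close>

lemma (in prob_space) expectation_additional_samples_hits:
  fixes B S :: "('b::euclidean_space) set"
  assumes Y: "uniform_draws M B r m N Y"
    and B: "B \<in> lmeasurable" "0 < measure lebesgue (scaled_set B (r k))"
    and k: "1 \<le> k" "k \<le> m"
    and S: "S \<in> sets lebesgue" "S \<subseteq> scaled_set B (r k)"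
  defines "A \<equiv> \<lambda>\<omega>. additional_samples B r m N (\<lambda>k j. Y k j \<omega>) k"
  shows "expectation (\<lambda>\<omega>. real (card {j. j < A \<omega> \<and> Y k j \<omega> \<in> S}))
       = expectation (\<lambda>\<omega>. real (A \<omega>)) * (measure lebesgue S / measure lebesgue (scaled_set B (r k)))"
proof -
  define p where "p = measure lebesgue S / measure lebesgue (scaled_set B (r k))"
  have ind: "indep_vars (\<lambda>_. lebesgue) (\<lambda>(k, j). Y k j) ({1..m} \<times> {..<N})"
    and dist: "\<And>j. j < N \<Longrightarrow> distr M lebesgue (Y k j) = uniform_measure lebesgue (scaled_set B (r k))"
    using Y k by (auto simp: uniform_draws_def)
  have Ym: "Y k' j \<in> M \<rightarrow>\<^sub>M lebesgue" if "1 \<le> k'" "k' \<le> m" "j < N" for k' j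
    using ind that by (auto simp: indep_vars_def)
  have Am[measurable]: "A \<in> M \<rightarrow>\<^sub>M count_space UNIV"
    unfolding A_def using k B by (intro measurable_additional_samples Ym) auto
  note S(1)[measurable]
  have hit: "prob {\<omega> \<in> space M. j < A \<omega> \<and> Y k j \<omega> \<in> S} = prob {\<omega> \<in> space M. j < A \<omega>} * p"
    if j: "j < N" for j
  proof -
    \<comment> \<open>The block \<open>?K\<close> determines how many draws are consumed at
      \<open>r k\<close>; it is disjoint from the index \<open>(k, j)\<close>, so the two restricted
      families are independent.\<close>
    let ?K = "{k<..m} \<times> {..<N}"
    let ?PK = "\<Pi>\<^sub>M i\<in>?K. (lebesgue :: 'b measure)"
    let ?Pj = "\<Pi>\<^sub>M i\<in>{(k, j)}. (lebesgue :: 'b measure)"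
    let ?f = "\<lambda>w. additional_samples B r m N (\<lambda>k j. w (k, j)) k"
    let ?X = "\<lambda>I \<omega>. restrict (\<lambda>i. (case i of (k, j) \<Rightarrow> Y k j) \<omega>) I"
    have f[measurable]: "?f \<in> ?PK \<rightarrow>\<^sub>M count_space UNIV"
      using B by (intro measurable_additional_samples measurable_component_singleton) auto
    have f': "(\<lambda>w. j < ?f w) \<in> ?PK \<rightarrow>\<^sub>M count_space UNIV" by measurable
    have g: "(\<lambda>w. w (k, j) \<in> S) \<in> ?Pj \<rightarrow>\<^sub>M count_space UNIV"
    proof (rule pred_sets2[OF S(1)])
      show "(\<lambda>w. w (k, j)) \<in> ?Pj \<rightarrow>\<^sub>M (lebesgue :: 'b measure)"
        by (intro measurable_component_singleton) auto
    qed
    have "indep_var ?PK (?X ?K) ?Pj (?X {(k, j)})"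
      using k j by (intro indep_var_restrict[OF ind]) auto
    from indep_var_compose[OF this f' g]
    have "indep_var (count_space UNIV) ((\<lambda>w. j < ?f w) \<circ> ?X ?K)
      (count_space UNIV) ((\<lambda>w. w (k, j) \<in> S) \<circ> ?X {(k, j)})" .
    \<comment> \<open>Outside \<open>?K\<close> the restricted family is \<open>undefined\<close>,
      but those entries do not affect the count.\<close>
    moreover have "?f (?X ?K \<omega>) = A \<omega>" for \<omega>
      unfolding A_def by (intro additional_samples_cong) auto
    ultimately have "indep_var (count_space UNIV) (\<lambda>\<omega>. j < A \<omega>) (count_space UNIV) (\<lambda>\<omega>. Y k j \<omega> \<in> S)"
      by (simp add: comp_def)
    from indep_varD[OF this, of "{True}" "{True}"]
    have "prob ((\<lambda>x. (j < A x, Y k j x \<in> S)) -` ({True} \<times> {True}) \<inter> space M) =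
      prob ((\<lambda>x. j < A x) -` {True} \<inter> space M) * prob ((\<lambda>x. Y k j x \<in> S) -` {True} \<inter> space M)"
      by simp
    moreover have "(\<lambda>x. Y k j x \<in> S) -` {True} \<inter> space M = Y k j -` S \<inter> space M" by auto
    moreover have "prob (Y k j -` S \<inter> space M) = p"
    proof -
      have "prob (Y k j -` S \<inter> space M) = measure (distr M lebesgue (Y k j)) S"
        using Ym[OF k j] S by (simp add: measure_distr)
      also have "\<dots> = measure lebesgue (scaled_set B (r k) \<inter> S) / measure lebesgue (scaled_set B (r k))"
        unfolding dist[OF j]
      proof (rule measure_uniform_measure)
        show "emeasure lebesgue (scaled_set B (r k)) \<noteq> 0"
          using B by (auto simp: measure_def)
        show "emeasure lebesgue (scaled_set B (r k)) \<noteq> \<infinity>"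
          using lmeasurable_scaled_set[OF B(1), of "r k"] by (auto simp: fmeasurable_def)
      qed (rule S)
      finally show ?thesis using S by (simp add: p_def Int_absorb1)
    qed
    moreover have "(\<lambda>x. (j < A x, Y k j x \<in> S)) -` ({True} \<times> {True}) \<inter> space M = {\<omega> \<in> space M. j < A \<omega> \<and> Y k j \<omega> \<in> S}"
      "(\<lambda>x. j < A x) -` {True} \<inter> space M = {\<omega> \<in> space M. j < A \<omega>}" by auto
    ultimately show ?thesis by simp
  qed
  \<comment> \<open>Kept general in \<open>P\<close>: hitting \<open>S\<close> gives the left side
    of the claim, and the constant \<open>True\<close> gives the tail-sum formula for the
    expectation of \<open>A\<close>.\<close>
  have count: "expectation (\<lambda>\<omega>. real (card {j. j < A \<omega> \<and> P j \<omega>}))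
      = (\<Sum>j<N. prob {\<omega> \<in> space M. j < A \<omega> \<and> P j \<omega>})"
    if P: "\<And>j. j < N \<Longrightarrow> Measurable.pred M (P j)" for P
  proof -
    have ev: "{\<omega> \<in> space M. j < A \<omega> \<and> P j \<omega>} \<in> events" if "j < N" for j
    proof -
      note P[OF that, measurable]
      show ?thesis by measurable
    qed
    have "expectation (\<lambda>\<omega>. real (card {j. j < A \<omega> \<and> P j \<omega>}))
        = expectation (\<lambda>\<omega>. \<Sum>j<N. indicator {\<omega> \<in> space M. j < A \<omega> \<and> P j \<omega>} \<omega>)"
    proof (rule Bochner_Integration.integral_cong[OF refl])
      fix \<omega> assume "\<omega> \<in> space M"
      moreover have "A \<omega> \<le> N" unfolding A_def by (rule additional_samples_le)
      ultimately show "real (card {j. j < A \<omega> \<and> P j \<omega>})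
          = (\<Sum>j<N. indicator {\<omega> \<in> space M. j < A \<omega> \<and> P j \<omega>} \<omega>)"
        unfolding card_less_conj_eq_sum[OF \<open>A \<omega> \<le> N\<close>] of_nat_sum
        by (intro sum.cong) (auto simp: indicator_def)
    qed
    also have "\<dots> = (\<Sum>j<N. prob {\<omega> \<in> space M. j < A \<omega> \<and> P j \<omega>})"
      using ev by (subst Bochner_Integration.integral_sum) (auto simp: emeasure_eq_measure)
    finally show ?thesis .
  qed
  have "expectation (\<lambda>\<omega>. real (card {j. j < A \<omega> \<and> Y k j \<omega> \<in> S}))
      = (\<Sum>j<N. prob {\<omega> \<in> space M. j < A \<omega> \<and> Y k j \<omega> \<in> S})"
    by (rule count, rule pred_sets2[OF S(1) Ym[OF k]])
  also have "\<dots> = (\<Sum>j<N. prob {\<omega> \<in> space M. j < A \<omega>}) * p"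
    using hit by (simp add: sum_distrib_right)
  also have "(\<Sum>j<N. prob {\<omega> \<in> space M. j < A \<omega>}) = expectation (\<lambda>\<omega>. real (A \<omega>))"
    using count[of "\<lambda>_ _. True"] by simp
  finally show ?thesis by (simp add: p_def)
qed

text \<open>For \<open>i < m\<close> the value is \<open>N\<close> times the chance that a uniform
  point of the next larger dilate misses the current one, as if all \<open>N\<close> samples
  available there were uniform.\<close>

lemma (in prob_space) expectation_additional_samples:
  fixes B :: "('b::euclidean_space) set"
  assumes Y: "uniform_draws M B r m N Y"
    and B: "B \<in> lmeasurable" "0 < measure lebesgue B"
    and star: "\<And>X c. X \<in> B \<Longrightarrow> 0 \<le> c \<Longrightarrow> c \<le> 1 \<Longrightarrow> c *\<^sub>R X \<in> B"
    and r_pos: "\<And>i. 1 \<le> i \<Longrightarrow> i \<le> m \<Longrightarrow> 0 < r i"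
    and r_mono: "\<And>i j. 1 \<le> i \<Longrightarrow> i \<le> j \<Longrightarrow> j \<le> m \<Longrightarrow> r i \<le> r j"
    and i: "1 \<le> i" "i \<le> m"
  defines "E \<equiv> \<lambda>i. expectation (\<lambda>\<omega>. real (additional_samples B r m N (\<lambda>k j. Y k j \<omega>) i))"
  shows "E i = (if i = m then real N else real N * (1 - (r i / r (i + 1)) ^ DIM('b)))"
proof -
  let ?A = "\<lambda>k \<omega>. additional_samples B r m N (\<lambda>k j. Y k j \<omega>) k"
  let ?C = "\<lambda>k i \<omega>. card {j. j < ?A k \<omega> \<and> Y k j \<omega> \<in> scaled_set B (r i)}"
  define v where "v i = measure lebesgue (scaled_set B (r i))" for i
  have nested: "scaled_set B (r i) \<subseteq> scaled_set B (r j)" if "1 \<le> i" "i \<le> j" "j \<le> m" for i j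
    using r_pos[of i] r_pos[of j] r_mono[of i j] that by (intro scaled_set_mono star) auto
  have v_pos: "0 < v i" if "1 \<le> i" "i \<le> m" for i
    using r_pos[OF that] B by (simp add: v_def measure_scaled_set)
  have Ym: "Y k j \<in> M \<rightarrow>\<^sub>M lebesgue" if "1 \<le> k" "k \<le> m" "j < N" for k j
    using Y that by (auto simp: uniform_draws_def indep_vars_def)
  have Am: "?A k \<in> M \<rightarrow>\<^sub>M count_space UNIV" if "1 \<le> k" for k
    using B that by (intro measurable_additional_samples Ym) auto
  have C_int: "integrable M (\<lambda>\<omega>. real (?C k i \<omega>))" if "1 \<le> k" "k \<le> m" for k i
  proof (rule integrable_const_bound[where B = "real N"])
    have "?C k i \<omega> \<le> N" for \<omega>
    proof -
      have "?C k i \<omega> \<le> card {..<?A k \<omega>}" by (intro card_mono) auto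
      then show ?thesis using additional_samples_le[of B r m N "\<lambda>k j. Y k j \<omega>" k] by simp
    qed
    then show "AE \<omega> in M. norm (real (?C k i \<omega>)) \<le> real N" by simp
    note [measurable] = sets_lebesgue_scaled_set[OF fmeasurableD[OF B(1)], of "r i"]
      Am[OF that(1)]
    have [measurable]: "Y k j \<in> M \<rightarrow>\<^sub>M lebesgue" if "j < N" for j
      using Ym \<open>1 \<le> k\<close> \<open>k \<le> m\<close> that by auto
    show "(\<lambda>\<omega>. real (?C k i \<omega>)) \<in> borel_measurable M"
      by (subst card_less_conj_eq_sum[OF additional_samples_le]) measurable
  qed
  text \<open>Taking expectations in the defining recursion and dividing by \<open>v i\<close> makes the sum telescope.\<close>
  have rec: "(\<Sum>k\<in>{i..m}. E k / v k) = real N / v i" if i: "1 \<le> i" "i \<le> m" for i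
  proof -
    have "E i = expectation (\<lambda>\<omega>. real N - (\<Sum>k\<in>{i<..m}. real (?C k i \<omega>)))"
      unfolding E_def using nested i by (subst real_additional_samples) auto
    also have "\<dots> = real N - (\<Sum>k\<in>{i<..m}. expectation (\<lambda>\<omega>. real (?C k i \<omega>)))"
    proof -
      have int: "integrable M (\<lambda>\<omega>. real (?C k i \<omega>))" if "k \<in> {i<..m}" for k
        using that i by (intro C_int) auto
      have "expectation (\<lambda>\<omega>. real N - (\<Sum>k\<in>{i<..m}. real (?C k i \<omega>)))
          = expectation (\<lambda>\<omega>. real N) - expectation (\<lambda>\<omega>. \<Sum>k\<in>{i<..m}. real (?C k i \<omega>))"
        using int by (intro Bochner_Integration.integral_diff Bochner_Integration.integrable_sum) auto
      also have "expectation (\<lambda>\<omega>. \<Sum>k\<in>{i<..m}. real (?C k i \<omega>))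
          = (\<Sum>k\<in>{i<..m}. expectation (\<lambda>\<omega>. real (?C k i \<omega>)))"
        using int by (intro Bochner_Integration.integral_sum)
      finally show ?thesis by (simp add: prob_space)
    qed
    \<comment> \<open>The Wald-type identity with the dilate at \<open>r i\<close> as target set,
      contained in the one at \<open>r k\<close> by nestedness.\<close>
    also have "(\<Sum>k\<in>{i<..m}. expectation (\<lambda>\<omega>. real (?C k i \<omega>))) = (\<Sum>k\<in>{i<..m}. E k * (v i / v k))"
    proof (rule sum.cong[OF refl])
      fix k assume k: "k \<in> {i<..m}"
      then show "expectation (\<lambda>\<omega>. real (?C k i \<omega>)) = E k * (v i / v k)"
        unfolding E_def v_def
        using i nested v_pos[of k] sets_lebesgue_scaled_set[OF fmeasurableD[OF B(1)], of "r i"]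
        by (intro expectation_additional_samples_hits[OF Y B(1)]) (auto simp: v_def)
    qed
    finally have "E i / v i = real N / v i - (\<Sum>k\<in>{i<..m}. E k / v k)"
      using v_pos[OF i] by (simp add: field_simps sum_distrib_left sum_distrib_right)
    moreover have "{i..m} = insert i {i<..m}" using i by auto
    ultimately show ?thesis by simp
  qed
  show ?thesis
  proof (cases "i = m")
    case True
    then show ?thesis using rec[OF i] v_pos[OF i] by simp
  next
    case False
    then have i': "1 \<le> i + 1" "i + 1 \<le> m" using i by auto
    have "{i..m} = insert i {i + 1..m}" using i by auto
    \<comment> \<open>The tail of the sum for \<open>i\<close> is the whole sum for
      \<open>i + 1\<close>, already known to be \<open>N / v (i + 1)\<close>.\<close>
    then have "E i / v i + real N / v (i + 1) = real N / v i"
      using rec[OF i] rec[OF i'] by simp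
    then have "E i = real N * (1 - v i / v (i + 1))"
      using v_pos[OF i] v_pos[OF i'] by (simp add: field_simps)
    moreover have "v i / v (i + 1) = (r i / r (i + 1)) ^ DIM('b)"
      using r_pos[OF i] r_pos[OF i'] B by (simp add: v_def measure_scaled_set power_divide)
    ultimately show ?thesis using False by simp
  qed
qed

text \<open>The leading 1 is the full sample at the largest radius, where nothing can be
  reused.\<close>

lemma (in prob_space) expected_total_eq:
  fixes B :: "('b::euclidean_space) set"
  assumes Y: "uniform_draws M B r m N Y"
    and B: "B \<in> lmeasurable" "0 < measure lebesgue B"
    and star: "\<And>X c. X \<in> B \<Longrightarrow> 0 \<le> c \<Longrightarrow> c \<le> 1 \<Longrightarrow> c *\<^sub>R X \<in> B"
    and r_pos: "\<And>i. 1 \<le> i \<Longrightarrow> i \<le> m \<Longrightarrow> 0 < r i"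
    and r_mono: "\<And>i j. 1 \<le> i \<Longrightarrow> i \<le> j \<Longrightarrow> j \<le> m \<Longrightarrow> r i \<le> r j"
    and m: "1 \<le> m"
  shows "expected_total M B r m N Y =
    real N * (1 + (\<Sum>i\<in>{1..<m}. 1 - (r i / r (i + 1)) ^ DIM('b)))"
proof -
  let ?A = "\<lambda>k \<omega>. additional_samples B r m N (\<lambda>k j. Y k j \<omega>) k"
  have Ym: "Y k j \<in> M \<rightarrow>\<^sub>M lebesgue" if "1 \<le> k" "k \<le> m" "j < N" for k j
    using Y that by (auto simp: uniform_draws_def indep_vars_def)
  have A_int: "integrable M (\<lambda>\<omega>. real (?A k \<omega>))" if "1 \<le> k" for k
  proof (rule integrable_const_bound[where B = "real N"])
    show "AE \<omega> in M. norm (real (?A k \<omega>)) \<le> real N" by (simp add: additional_samples_le)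
    have [measurable]: "?A k \<in> M \<rightarrow>\<^sub>M count_space UNIV"
      using B that by (intro measurable_additional_samples Ym) auto
    show "(\<lambda>\<omega>. real (?A k \<omega>)) \<in> borel_measurable M" by measurable
  qed
  have "expected_total M B r m N Y = (\<Sum>i=1..m. expectation (\<lambda>\<omega>. real (?A i \<omega>)))"
    using A_int by (simp add: expected_total_def total_samples_def Bochner_Integration.integral_sum)
  also have "\<dots> = (\<Sum>i=1..m. if i = m then real N else real N * (1 - (r i / r (i + 1)) ^ DIM('b)))"
    by (intro sum.cong refl expectation_additional_samples Y B star r_pos r_mono) auto
  also have "{1..m} = insert m {1..<m}" using m by auto
  also have "(\<Sum>i\<in>insert m {1..<m}. if i = m then real N else real N * (1 - (r i / r (i + 1)) ^ DIM('b)))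
      = real N + (\<Sum>i\<in>{1..<m}. real N * (1 - (r i / r (i + 1)) ^ DIM('b)))"
    by (auto intro!: sum.cong)
  finally show ?thesis by (simp add: sum_distrib_left distrib_left)
qed

subsection \<open>The geometric grid\<close>

theorem theorem4:
  fixes B :: "(real ^ 'd) set"
    and req :: "real ^ 'd \<Rightarrow> bool"
    and a lam eps :: real
    and d m N :: nat
    and r :: "nat \<Rightarrow> real"
    and M :: "'w measure"
    and Y :: "nat \<Rightarrow> nat \<Rightarrow> 'w \<Rightarrow> real ^ 'd"
  assumes d: "d = CARD('d)"
    and B_meas: "B \<in> sets lebesgue"
    and B_vol: "0 < emeasure lebesgue B" "emeasure lebesgue B < \<infinity>"
    and B_star: "\<And>X c. X \<in> B \<Longrightarrow> 0 \<le> c \<Longrightarrow> c \<le> 1 \<Longrightarrow> c *\<^sub>R X \<in> B"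
    and req_meas: "{X. req X} \<in> sets lebesgue"
    and a: "0 < a" and lam: "1 < lam" and eps: "0 < eps" "eps < 1"
    and m: "m = 2 + nat \<lfloor>ln lam / ln (1 + 2 * eps / real d)\<rfloor>"
    and r: "\<And>i. 1 \<le> i \<Longrightarrow> i \<le> m \<Longrightarrow>
              r i = a * (1 / lam) powr ((real m - real i) / (real m - 1))"
    and N: "1 \<le> N"
    and M: "prob_space M"
    and Y: "uniform_draws M B r m N Y"
  shows "(\<forall>i\<in>{1..m - 1}. \<forall>x\<in>{r i..r (i + 1)}.
            \<bar>robust_prob B req x - interpolant (robust_prob B req) r i x\<bar> < eps)
       \<and> equiv_grid_points M B r m N Y =
           1 + (1 + of_int \<lfloor>ln lam / ln (1 + 2 * eps / real d)\<rfloor>) *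
               (1 - (1 / lam) powr
                  (real d / (1 + of_int \<lfloor>ln lam / ln (1 + 2 * eps / real d)\<rfloor>)))
       \<and> reuse_factor M B r m N Y > 1 / (2 * eps) * (1 - 1 / (1 + real d * ln lam))"
proof -
  \<comment> \<open>\<open>n = m - 1\<close> is the number of grid intervals and
    \<open>\<rho>\<close> the constant ratio of consecutive radii.\<close>
  define L K n \<rho> where "L = ln lam" and "K = \<lfloor>L / ln (1 + 2 * eps / real d)\<rfloor>"
    and "n = 1 + real_of_int K" and "\<rho> = (1 / lam) powr (1 / n)"
  have d_pos: "0 < real d" using d by simp
  have dim: "DIM(real ^ 'd) = d" using d by simp
  have L_pos: "0 < L" using lam by (simp add: L_def)
  define x where "x = 2 * eps / real d"
  have x_pos: "0 < x" using eps d_pos by (simp add: x_def)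
  then have ln_pos: "0 < ln (1 + x)" by simp
  have "0 \<le> L / ln (1 + x)" using L_pos ln_pos by simp
  then have K_nonneg: "0 \<le> K" unfolding K_def x_def by simp
  have n_pos: "0 < n" using K_nonneg by (simp add: n_def)
  have m_eq: "m = 2 + nat K" using m by (simp add: K_def L_def)
  have m_n: "real m = 1 + n" using m_eq K_nonneg by (simp add: n_def)
  \<comment> \<open>One more than the floor strictly exceeds the quotient; this is the source of the
    strict inequality in (I).\<close>
  have "L / ln (1 + x) < n" unfolding n_def K_def x_def by linarith
  then have n_gt: "L < n * ln (1 + x)" using ln_pos by (simp add: pos_divide_less_eq)
  have \<rho>: "0 < \<rho>" using lam by (simp add: \<rho>_def)
  have \<rho>_ln: "ln \<rho> = - L / n" using lam by (simp add: \<rho>_def L_def ln_powr ln_div)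
  have "ln \<rho> < 0" using \<rho>_ln L_pos n_pos by (simp add: divide_neg_pos)
  then have \<rho>_less: "\<rho> < 1" using \<rho> by simp
  have "ln (1 / \<rho>) < ln (1 + x)"
    using \<rho> n_gt n_pos by (simp add: ln_div \<rho>_ln pos_divide_less_eq mult.commute)
  then have \<rho>_step: "1 / \<rho> < 1 + x" using \<rho> x_pos by (subst (asm) ln_less_cancel_iff) auto
  have r_eq: "r i = a * (1 / lam) powr ((real m - real i) / n)" if "1 \<le> i" "i \<le> m" for i
    using r[OF that] m_n by simp
  have r_pos: "0 < r i" if "1 \<le> i" "i \<le> m" for i
    using r_eq[OF that] a lam by simp
  have r_mono: "r i \<le> r j" if "1 \<le> i" "i \<le> j" "j \<le> m" for i j
    using that a lam n_pos
    by (subst (1 2) r_eq) (auto intro!: mult_left_mono powr_mono' divide_right_mono)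
  have r_step: "r i / r (i + 1) = \<rho>" if "1 \<le> i" "i < m" for i
  proof -
    have "(real m - real i) / n = 1 / n + (real m - real (i + 1)) / n"
      using n_pos by (simp add: field_simps)
    then show ?thesis
      using that a lam by (simp add: r_eq \<rho>_def powr_add)
  qed
  have \<rho>_pow: "\<rho> ^ d = (1 / lam) powr (real d / n)"
    using lam by (simp add: \<rho>_def powr_realpow[symmetric] powr_powr)
  have B: "B \<in> lmeasurable" "0 < measure lebesgue B"
    using B_meas B_vol by (auto simp: fmeasurable_def measure_def enn2real_positive_iff top.not_eq_extremum)
  have I: "\<bar>robust_prob B req z - interpolant (robust_prob B req) r i z\<bar> < eps"
    if i: "i \<in> {1..m - 1}" and z: "z \<in> {r i..r (i + 1)}" for i z
  proof (rule interpolation_error_less[where n = d])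
    have i': "1 \<le> i" "i < m" using i m_eq by auto
    show ri: "0 < r i" using r_pos i' by simp
    have ri1: "0 < r (i + 1)" using r_pos i' by simp
    have eq: "r (i + 1) = r i * (1 / \<rho>)" using r_step[OF i'] ri ri1 by (auto simp: field_simps)
    show "r i < r (i + 1)" unfolding eq using ri \<rho> \<rho>_less by (simp add: field_simps)
    \<comment> \<open>On this grid the step condition reads
      \<open>d (1 / \<rho> - 1) < 2 eps\<close>, which is \<open>\<rho>_step\<close>.\<close>
    have "real d * (r (i + 1) - r i) = real d * r i * (1 / \<rho> - 1)"
      unfolding eq by (simp add: algebra_simps)
    also have "\<dots> < real d * r i * x"
      using \<rho>_step ri d_pos by (intro mult_strict_left_mono) auto
    also have "\<dots> = 2 * eps * r i" using d_pos by (simp add: x_def)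
    finally show "real d * (r (i + 1) - r i) < 2 * eps * r i" .
    show "\<bar>robust_prob B req t - robust_prob B req s\<bar> \<le> 1 - (s / t) ^ d" if "0 < s" "s \<le> t" for s t
      unfolding dim[symmetric] by (intro robust_prob_diff_le B B_star req_meas that)
  qed (rule z)
  have "expected_total M B r m N Y = real N * (1 + (\<Sum>i\<in>{1..<m}. 1 - (r i / r (i + 1)) ^ DIM(real ^ 'd)))"
    using m_eq by (intro prob_space.expected_total_eq M Y B B_star r_pos r_mono) auto
  also have "(\<Sum>i\<in>{1..<m}. 1 - (r i / r (i + 1)) ^ DIM(real ^ 'd)) = (\<Sum>i\<in>{1..<m}. 1 - \<rho> ^ d)"
    using r_step dim by (intro sum.cong) auto
  also have "\<dots> = n * (1 - \<rho> ^ d)" using m_n m_eq by (simp add: of_nat_diff)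
  finally have E: "expected_total M B r m N Y = real N * (1 + n * (1 - \<rho> ^ d))" .
  have II: "equiv_grid_points M B r m N Y = 1 + n * (1 - (1 / lam) powr (real d / n))"
    using N by (simp add: equiv_grid_points_def E \<rho>_pow)
  have III: "reuse_factor M B r m N Y > 1 / (2 * eps) * (1 - 1 / (1 + real d * L))"
  proof -
    \<comment> \<open>\<open>1 + q\<close> is the equivalent number of grid points, so the reuse
      factor is \<open>m / (1 + q)\<close>. It remains to bound \<open>q\<close> above by
      \<open>d L\<close> and \<open>m\<close> below by \<open>d L / (2 eps)\<close>.\<close>
    define q where "q = n * (1 - \<rho> ^ d)"
    have "\<rho> ^ d \<le> 1" using \<rho> \<rho>_less by (simp add: power_le_one)
    then have q_nonneg: "0 \<le> q" using n_pos by (simp add: q_def)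
    have "\<rho> ^ d = exp (real d * ln \<rho>)" using \<rho> by (simp add: exp_of_nat_mult)
    \<comment> \<open>The inequality \<open>1 - exp (-y) \<le> y\<close> at
      \<open>y = d L / n\<close>.\<close>
    then have "1 - \<rho> ^ d \<le> real d * L / n"
      using exp_ge_add_one_self[of "real d * ln \<rho>"] by (simp add: \<rho>_ln)
    then have q_le: "q \<le> real d * L" using n_pos by (simp add: q_def field_simps)
    have "L < n * x"
      using n_gt mult_left_mono[OF ln_add_one_self_le_self[of x], of n] x_pos n_pos by linarith
    then have "real d * L < 2 * eps * n" using d_pos by (simp add: x_def field_simps)
    also have "\<dots> < 2 * eps * real m" using m_n eps by simp
    finally have m_gt: "real d * L / (2 * eps) < real m" using eps by (simp add: field_simps)
    have dL: "0 < real d * L" using d_pos L_pos by simp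
    \<comment> \<open>In this form the bound can be compared with \<open>m / (1 + q)\<close> first
      in the numerator, then in the denominator.\<close>
    have "1 / (2 * eps) * (1 - 1 / (1 + real d * L)) = real d * L / (2 * eps) / (1 + real d * L)"
      using dL eps by (simp add: divide_simps)
    also have "\<dots> < real m / (1 + real d * L)" using m_gt dL by (intro divide_strict_right_mono) auto
    also have "\<dots> \<le> real m / (1 + q)" using q_le q_nonneg by (intro divide_left_mono) auto
    also have "\<dots> = reuse_factor M B r m N Y"
      using N by (simp add: reuse_factor_def E q_def)
    finally show ?thesis .
  qed
  show ?thesis
    using I II III unfolding n_def K_def L_def by blast
qed

end
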